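(* Let $\gamma:\mathbb{S}^1\to\mathbb{R}^2$ be a smooth, closed, translating solution of the length-constrained curve diffusion flow with circumference length $L_0$. Then $\gamma(\mathbb{S}^1)$ is the stationary round circle of circumference $L_0$.
   Context: For a closed regular plane curve $\gamma$, $s$ is arc length, $\nu$ is the unit normal obtained by rotating the unit tangent $\gamma_s$ by $+\pi/2$, $k$ is the scalar curvature ($\gamma_{ss}=k\nu$), subscripts $s$ denote arc length derivatives, and $\omega=\frac1{2\pi}\int k\,ds$ is the winding number. The length-constrained curve diffusion flow is the flow of closed plane curves with normal velocity $$\partial_t^\perp\gamma:=\langle\partial_t\gamma,\nu\rangle=h-k_{ss},\qquad h=-\frac{\int_\gamma k_s^2\,ds}{2\pi\omega}$$ (the definition of $h$ presupposes $\omega\neq0$). Length is constant along the flow. A closed curve $\gamma$ is a translating solution if its image evolves under the flow purely by translation, i.e. if there is a constant vector $V\in\mathbb{R}^2$ with $h-k_{ss}=\langle V,\nu\rangle$ along $\gamma$. It is stationary if $h-k_{ss}\equiv0$.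
   Formalization: The circumference is counted with multiplicity: the image is a round circle covered |ω| times, with L_0 equal to |ω| times its circumference; as literally stated the claim fails for multiply covered circles such as z ↦ z^2 and holds exactly when |ω| = 1. *)

theory Defs
  imports "HOL-Analysis.Analysis"
begin

text \<open>
  The plane is the type of complex numbers with its real inner product, and \<open>\<S>\<^sup>1\<close> is
  \<open>sphere 0 1\<close>. A closed curve is a map \<open>\<gamma>\<close> of which only the values on \<open>sphere 0 1\<close> are used.
  Functions along the curve (tangent, normal, curvature) are functions of the
  angle \<open>t\<close> of the point \<open>cis t\<close> of \<open>\<S>\<^sup>1\<close>; they are \<open>2\<pi>\<close>-periodic.
\<close>

definition angle_lift :: "(complex \<Rightarrow> complex) \<Rightarrow> real \<Rightarrow> complex" where
  "angle_lift \<gamma> t = \<gamma> (cis t)"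

definition smooth_on_reals :: "(real \<Rightarrow> 'a::real_normed_vector) \<Rightarrow> bool" where
  "smooth_on_reals f \<longleftrightarrow>
     (\<forall>n. ((\<lambda>g t. vector_derivative g (at t)) ^^ n) f differentiable_on UNIV)"

definition smooth_closed_regular_curve :: "(complex \<Rightarrow> complex) \<Rightarrow> bool" where
  "smooth_closed_regular_curve \<gamma> \<longleftrightarrow>
     smooth_on_reals (angle_lift \<gamma>) \<and>
     (\<forall>t. vector_derivative (angle_lift \<gamma>) (at t) \<noteq> 0)"

definition speed :: "(complex \<Rightarrow> complex) \<Rightarrow> real \<Rightarrow> real" where
  "speed \<gamma> t = norm (vector_derivative (angle_lift \<gamma>) (at t))"

definition arc_deriv ::
  "(complex \<Rightarrow> complex) \<Rightarrow> (real \<Rightarrow> 'a::real_normed_vector) \<Rightarrow> real \<Rightarrow> 'a" where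
  "arc_deriv \<gamma> f t = vector_derivative f (at t) /\<^sub>R speed \<gamma> t"

definition arc_integral :: "(complex \<Rightarrow> complex) \<Rightarrow> (real \<Rightarrow> real) \<Rightarrow> real" where
  "arc_integral \<gamma> f = integral {0..2 * pi} (\<lambda>t. f t * speed \<gamma> t)"

definition curve_length :: "(complex \<Rightarrow> complex) \<Rightarrow> real" where
  "curve_length \<gamma> = arc_integral \<gamma> (\<lambda>t. 1)"

definition unit_tangent :: "(complex \<Rightarrow> complex) \<Rightarrow> real \<Rightarrow> complex" where
  "unit_tangent \<gamma> = arc_deriv \<gamma> (angle_lift \<gamma>)"

definition unit_normal :: "(complex \<Rightarrow> complex) \<Rightarrow> real \<Rightarrow> complex" where
  "unit_normal \<gamma> t = \<i> * unit_tangent \<gamma> t"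

text \<open>For a regular curve \<open>\<gamma>\<^sub>s\<^sub>s\<close> is a multiple of the unit vector \<open>\<nu>\<close>, so
  \<open>\<gamma>\<^sub>s\<^sub>s = k \<nu>\<close> says that \<open>k = \<langle>\<gamma>\<^sub>s\<^sub>s, \<nu>\<rangle>\<close>.\<close>

definition curvature :: "(complex \<Rightarrow> complex) \<Rightarrow> real \<Rightarrow> real" where
  "curvature \<gamma> t = arc_deriv \<gamma> (unit_tangent \<gamma>) t \<bullet> unit_normal \<gamma> t"

text \<open>The winding number of the tangent, unlike the library's \<open>winding_number\<close>, which is that of
  the curve around a point.\<close>

definition turning_number :: "(complex \<Rightarrow> complex) \<Rightarrow> real" where
  "turning_number \<gamma> = arc_integral \<gamma> (curvature \<gamma>) / (2 * pi)"

text \<open>Meaningful only when the turning number is nonzero.\<close>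

definition length_constraint :: "(complex \<Rightarrow> complex) \<Rightarrow> real" where
  "length_constraint \<gamma> =
     - arc_integral \<gamma> (\<lambda>t. (arc_deriv \<gamma> (curvature \<gamma>) t)\<^sup>2) / (2 * pi * turning_number \<gamma>)"

definition flow_normal_velocity :: "(complex \<Rightarrow> complex) \<Rightarrow> real \<Rightarrow> real" where
  "flow_normal_velocity \<gamma> t =
     length_constraint \<gamma> - arc_deriv \<gamma> (arc_deriv \<gamma> (curvature \<gamma>)) t"

definition translating_solution :: "(complex \<Rightarrow> complex) \<Rightarrow> bool" where
  "translating_solution \<gamma> \<longleftrightarrow>
     (\<exists>V. \<forall>t. flow_normal_velocity \<gamma> t = V \<bullet> unit_normal \<gamma> t)"

definition stationary_solution :: "(complex \<Rightarrow> complex) \<Rightarrow> bool" where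
  "stationary_solution \<gamma> \<longleftrightarrow> (\<forall>t. flow_normal_velocity \<gamma> t = 0)"

text \<open>
  The image of \<open>\<gamma>\<close> is a round circle of radius \<open>r\<close>, and \<open>\<gamma>\<close> runs through each of its points
  exactly \<open>m\<close> times. The circumference \<open>L\<close> is counted with this multiplicity: \<open>L = m (2\<pi>r)\<close>.
  For \<open>m = 1\<close> the image is the circle of circumference \<open>L\<close>. Multiplicities cannot be
  excluded for immersed curves: \<open>z \<mapsto> z\<^sup>m\<close> is stationary with length \<open>2\<pi>m\<close> and image \<open>\<S>\<^sup>1\<close>.
\<close>

definition round_circle_of_circumference ::
  "(complex \<Rightarrow> complex) \<Rightarrow> real \<Rightarrow> real \<Rightarrow> bool" where
  "round_circle_of_circumference \<gamma> m L \<longleftrightarrow>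
     (\<exists>c r. r > 0 \<and> \<gamma> ` sphere 0 1 = sphere c r \<and>
        (\<forall>p \<in> sphere c r. real (card {z \<in> sphere 0 1. \<gamma> z = p}) = m) \<and>
        L = m * (2 * pi * r))"

end

theory Submission
  imports Defs
begin

text \<open>
  Integrate \<open>h - k\<^sub>s\<^sub>s = \<langle>V, \<nu>\<rangle>\<close> along the curve. Since \<open>\<nu> = \<i> \<gamma>\<^sub>s\<close> and \<open>k\<^sub>s\<^sub>s\<close> are arc length
  derivatives of periodic functions, their integrals vanish, so \<open>h = 0\<close>. By the definition of \<open>h\<close>
  this means \<open>\<integral> k\<^sub>s\<^sup>2 = 0\<close>, so the curvature is a constant \<open>\<kappa>\<close>, nonzero because \<open>\<omega> \<noteq> 0\<close>. Then
  \<open>\<gamma> + \<i> \<gamma>\<^sub>s / \<kappa>\<close> is constant and \<open>\<gamma>\<^sub>s\<close> rotates uniformly in \<open>s\<close>, through the total angle \<open>2\<pi>\<omega>\<close>.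
\<close>

section \<open>Uniform rotations\<close>

lemma cis_eq_cis_iff: "cis x = cis y \<longleftrightarrow> (\<exists>n::int. x = y + 2 * pi * n)"
  using sin_cos_eq_iff[of x y] by (auto simp: complex_eq_iff)

text \<open>\<open>Arg2pi\<close> is the inverse. Omitting the right endpoint gives every point of
  the circle exactly one angle.\<close>

lemma bij_betw_cis: "bij_betw cis {0..<2 * pi} (sphere 0 1)"
proof -
  have inj: "inj_on cis {0..<2 * pi}"
  proof (rule inj_onI)
    fix x y assume x: "x \<in> {0..<2 * pi}" and y: "y \<in> {0..<2 * pi}" and "cis x = cis y"
    then have "Arg2pi (cis x) = x" "Arg2pi (cis y) = y"
      by (auto intro!: Arg2pi_unique[of 1] simp: cis_conv_exp)
    with \<open>cis x = cis y\<close> show "x = y" by metis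
  qed
  have "z \<in> cis ` {0..<2 * pi}" if "norm z = 1" for z
  proof -
    have "cis (Arg2pi z) = of_real (norm z) * exp (\<i> * of_real (Arg2pi z))"
      by (simp only: that cis_conv_exp of_real_1 mult_1)
    also have "\<dots> = z"
      by (rule Arg2pi_eq[symmetric])
    finally show ?thesis
      using Arg2pi_ge_0[of z] Arg2pi_lt_2pi[of z]
      by (intro image_eqI[of _ _ "Arg2pi z"]) simp_all
  qed
  with inj show ?thesis
    by (auto simp: bij_betw_def)
qed

text \<open>The angles of \<open>w\<close> form one arithmetic progression with step 2 pi, and a
  half-open interval of N full turns contains exactly N of its terms. This is the source of the
  multiplicity of the circle.\<close>

lemma card_cis_eq:
  assumes "norm w = 1"
  shows "card {u \<in> {0..<2 * pi * real N}. cis u = w} = N"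
proof -
  obtain \<theta> where \<theta>: "0 \<le> \<theta>" "\<theta> < 2 * pi" "cis \<theta> = w"
  proof -
    have "w \<in> cis ` {0..<2 * pi}"
      using assms bij_betw_cis by (simp add: bij_betw_def)
    then show thesis using that by auto
  qed
  let ?f = "\<lambda>j::nat. \<theta> + 2 * pi * real j"
  have "{u \<in> {0..<2 * pi * real N}. cis u = w} = ?f ` {..<N}"
  proof (intro equalityI subsetI)
    fix u assume u: "u \<in> {u \<in> {0..<2 * pi * real N}. cis u = w}"
    then obtain n :: int where n: "u = \<theta> + 2 * pi * n"
      using \<theta>(3) cis_eq_cis_iff[of u \<theta>] by auto
    have u': "0 \<le> u" "u < 2 * pi * real N" using u by auto
    \<comment> \<open>From 0 <= u and \<open>\<theta>\<close> < 2 pi, the difference 2 pi n exceeds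
      -2 pi. Strictness gives n > -1, hence n >= 0 for an integer.\<close>
    have "2 * pi * (- 1) < 2 * pi * n" using u' n \<theta> by linarith
    then have "real_of_int (- 1) < n" by (subst (asm) mult_less_cancel_left_pos) auto
    then have "0 \<le> n" by linarith
    moreover have "2 * pi * n < 2 * pi * real N" using u' n \<theta> by linarith
    then have "n < real N" by (subst (asm) mult_less_cancel_left_pos) auto
    then have "n < int N" by linarith
    ultimately show "u \<in> ?f ` {..<N}"
      using n by (intro image_eqI[of _ _ "nat n"]) auto
  next
    fix u assume "u \<in> ?f ` {..<N}"
    then obtain j where j: "j < N" "u = ?f j" by auto
    have "cis u = w"
      using \<theta>(3) cis_eq_cis_iff[of u \<theta>] j(2) by (auto intro: exI[of _ "int j"])
    moreover have "u < 2 * pi * real N"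
    proof -
      have "u < 2 * pi * (real j + 1)" using j \<theta> by (simp add: algebra_simps)
      also have "\<dots> \<le> 2 * pi * real N" using j by (intro mult_left_mono) auto
      finally show ?thesis .
    qed
    ultimately show "u \<in> {u \<in> {0..<2 * pi * real N}. cis u = w}"
      using j \<theta> by simp
  qed
  moreover have "inj_on ?f {..<N}" by (auto intro!: inj_onI)
  ultimately show ?thesis by (simp add: card_image)
qed

text \<open>For clockwise rotation, complex conjugation reduces the count to the counterclockwise
  one.\<close>

lemma card_cis_signed_eq:
  assumes "norm w = 1" "\<sigma> = 1 \<or> \<sigma> = - 1"
  shows "card {u \<in> {0..<2 * pi * real N}. cis (\<sigma> * u) = w} = N"
proof (cases "\<sigma> = 1")
  case True
  then show ?thesis using card_cis_eq[OF assms(1)] by simp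
next
  case False
  then have "cis (\<sigma> * u) = w \<longleftrightarrow> cis u = cnj w" for u
    using assms(2) by (metis cis_cnj complex_cnj_cnj mult_minus1)
  then show ?thesis using card_cis_eq[of "cnj w"] assms(1) by simp
qed

text \<open>Surjectivity is the intermediate value theorem; the right endpoints correspond only to
  each other and drop out together.\<close>

lemma bij_betw_atLeastLessThan_strict_mono:
  fixes g :: "real \<Rightarrow> real"
  assumes "strict_mono_on {a..b} g" "continuous_on {a..b} g" "a \<le> b"
  shows "bij_betw g {a..<b} {g a..<g b}"
proof (rule bij_betw_imageI)
  show "inj_on g {a..<b}"
    using assms(1) by (rule inj_on_subset[OF strict_mono_on_imp_inj_on]) auto
  show "g ` {a..<b} = {g a..<g b}"
  proof (intro equalityI subsetI)
    fix y assume "y \<in> g ` {a..<b}"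
    then obtain x where x: "a \<le> x" "x < b" "y = g x" by auto
    then show "y \<in> {g a..<g b}"
      using assms(3) strict_mono_onD[OF assms(1), of x b] strict_mono_onD[OF assms(1), of a x]
      by (cases "x = a") auto
  next
    fix y assume y: "y \<in> {g a..<g b}"
    then obtain x where "a \<le> x" "x \<le> b" "g x = y"
      using IVT'[of g a y b] assms(2,3) by auto
    with y show "y \<in> g ` {a..<b}" by (cases "x = b") auto
  qed
qed

text \<open>The fibre over \<open>p\<close> is transported along two bijections: from points of the
  circle to angles t, then by \<open>g\<close> to rotation angles in N full turns, where it can be
  counted.\<close>

lemma uniform_rotation_covers_circle:
  fixes \<gamma> :: "complex \<Rightarrow> complex"
  assumes g: "strict_mono_on {0..2 * pi} g" "continuous_on {0..2 * pi} g" "g 0 = 0"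
      "g (2 * pi) = 2 * pi * real N"
    and \<sigma>: "\<sigma> = 1 \<or> \<sigma> = - 1" and A: "A \<noteq> 0"
    and \<gamma>: "\<And>t. t \<in> {0..2 * pi} \<Longrightarrow> \<gamma> (cis t) = c + A * cis (\<sigma> * g t)"
  shows "\<gamma> ` sphere 0 1 = sphere c (norm A)"
    and "p \<in> sphere c (norm A) \<Longrightarrow> card {z \<in> sphere 0 1. \<gamma> z = p} = N"
proof -
  have count: "card {z \<in> sphere 0 1. \<gamma> z = p} = N" if p: "p \<in> sphere c (norm A)" for p
  proof -
    let ?w = "(p - c) / A"
    have w: "norm ?w = 1"
      using p A by (simp add: norm_divide dist_norm norm_minus_commute)
    have eq: "c + A * z = p \<longleftrightarrow> z = ?w" for z
      using A by (auto simp: field_simps)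
    have bg: "bij_betw g {0..<2 * pi} {0..<2 * pi * real N}"
      using bij_betw_atLeastLessThan_strict_mono[OF g(1,2)] g(3,4) by simp
    have "{z \<in> sphere 0 1. \<gamma> z = p} = cis ` {t \<in> {0..<2 * pi}. \<gamma> (cis t) = p}"
      unfolding bij_betw_imp_surj_on[OF bij_betw_cis, symmetric] by auto
    then have "card {z \<in> sphere 0 1. \<gamma> z = p} = card {t \<in> {0..<2 * pi}. \<gamma> (cis t) = p}"
      by (simp add: card_image inj_on_subset[OF bij_betw_imp_inj_on[OF bij_betw_cis]] subset_iff)
    also have "{t \<in> {0..<2 * pi}. \<gamma> (cis t) = p} = {t \<in> {0..<2 * pi}. cis (\<sigma> * g t) = ?w}"
      using \<gamma> by (intro Collect_cong conj_cong) (simp_all add: eq)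
    also have "card \<dots> = card (g ` {t \<in> {0..<2 * pi}. cis (\<sigma> * g t) = ?w})"
      by (rule card_image[symmetric]) (rule inj_on_subset[OF bij_betw_imp_inj_on[OF bg]], auto)
    also have "g ` {t \<in> {0..<2 * pi}. cis (\<sigma> * g t) = ?w}
        = {u \<in> {0..<2 * pi * real N}. cis (\<sigma> * u) = ?w}"
      unfolding bij_betw_imp_surj_on[OF bg, symmetric] by auto
    also have "card \<dots> = N" by (rule card_cis_signed_eq[OF w \<sigma>])
    finally show ?thesis .
  qed
  then show "p \<in> sphere c (norm A) \<Longrightarrow> card {z \<in> sphere 0 1. \<gamma> z = p} = N" .
  have "g 0 < g (2 * pi)" by (rule strict_mono_onD[OF g(1)]) auto
  \<comment> \<open>The strict increase of \<open>g\<close> forces at least one turn. Hence no fibre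
    is empty, which is surjectivity onto the circle.\<close>
  then have "N > 0" unfolding g(3,4) by (cases N) simp_all
  have "p \<in> \<gamma> ` sphere 0 1" if "p \<in> sphere c (norm A)" for p
  proof -
    have "{z \<in> sphere 0 1. \<gamma> z = p} \<noteq> {}"
    proof
      assume empty: "{z \<in> sphere 0 1. \<gamma> z = p} = {}"
      then show False using count[OF that] \<open>N > 0\<close> unfolding empty by simp
    qed
    then show ?thesis by blast
  qed
  moreover have "\<gamma> z \<in> sphere c (norm A)" if "z \<in> sphere 0 1" for z
  proof -
    have "z \<in> cis ` {0..<2 * pi}"
      using that bij_betw_imp_surj_on[OF bij_betw_cis] by simp
    then obtain t where "t \<in> {0..<2 * pi}" "z = cis t" by blast
    then show ?thesis using \<gamma>[of t] by (simp add: dist_norm norm_mult)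
  qed
  ultimately show "\<gamma> ` sphere 0 1 = sphere c (norm A)" by blast
qed

section \<open>Calculus along a curve\<close>

text \<open>Differentiability is not assumed: \<open>vector_derivative\<close> is a choice among the
  possible derivatives, and the candidates at t and at t + p are the same, so the choices
  agree.\<close>

lemma vector_derivative_periodic:
  fixes f :: "real \<Rightarrow> 'a::real_normed_vector"
  assumes "\<And>t. f (t + p) = f t"
  shows "vector_derivative f (at (t + p)) = vector_derivative f (at t)"
proof -
  have shift: "((\<lambda>x. f (x + q)) has_vector_derivative d) (at u)"
    if "(f has_vector_derivative d) (at (u + q))" for d u q
  proof -
    have "((\<lambda>x. x + q) has_vector_derivative 1) (at u)"
      unfolding has_real_derivative_iff_has_vector_derivative[symmetric]
      by (auto intro!: derivative_eq_intros)
    from vector_diff_chain_at[OF this that] show ?thesis by (simp add: o_def)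
  qed
  have "f (t - p) = f t" for t
    using assms[of "t - p"] by simp
  then have "(f has_vector_derivative d) (at (t + p)) \<longleftrightarrow> (f has_vector_derivative d) (at t)" for d
    using shift[of d t p] shift[of d "t + p" "- p"] assms by auto
  then show ?thesis by (simp add: vector_derivative_def)
qed

lemma has_real_derivative_inner:
  fixes f g :: "real \<Rightarrow> 'a::real_inner"
  assumes "(f has_vector_derivative f') (at t)" "(g has_vector_derivative g') (at t)"
  shows "((\<lambda>t. f t \<bullet> g t) has_real_derivative f t \<bullet> g' + f' \<bullet> g t) (at t)"
  unfolding has_real_derivative_iff_has_vector_derivative
  by (rule bounded_bilinear.has_vector_derivative[OF bounded_bilinear_inner assms])

lemma has_real_derivative_norm:
  fixes f :: "real \<Rightarrow> 'a::real_inner"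
  assumes "(f has_vector_derivative f') (at t)" "f t \<noteq> 0"
  shows "((\<lambda>t. norm (f t)) has_real_derivative (f t \<bullet> f') / norm (f t)) (at t)"
proof -
  have "f t \<bullet> f t > 0" using assms(2) by simp
  from DERIV_chain2[OF DERIV_real_sqrt[OF this] has_real_derivative_inner[OF assms(1) assms(1)]]
  show ?thesis
    by (simp add: norm_eq_sqrt_inner inner_commute field_simps)
qed

text \<open>A unit vector w and its quarter turn form an orthonormal basis of the plane.\<close>

lemma complex_orthogonal_decomp:
  fixes z w :: complex
  assumes "norm w = 1" "z \<bullet> w = 0"
  shows "z = (z \<bullet> (\<i> * w)) *\<^sub>R (\<i> * w)"
proof -
  have w: "(Re w)\<^sup>2 + (Im w)\<^sup>2 = 1"
    using assms(1) by (simp add: cmod_def)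
  have o: "Re z * Re w + Im z * Im w = 0"
    using assms(2) by (simp add: inner_complex_def)
  have "Re z = (Im z * Re w - Re z * Im w) * - Im w"
    using w o by algebra
  moreover have "Im z = (Im z * Re w - Re z * Im w) * Re w"
    using w o by algebra
  ultimately show ?thesis
    by (simp add: complex_eq_iff inner_complex_def algebra_simps)
qed

section \<open>Tangent and curvature in a general parameter\<close>

locale smooth_closed_curve =
  fixes \<gamma> :: "complex \<Rightarrow> complex"
  assumes smooth: "smooth_closed_regular_curve \<gamma>"
begin

text \<open>These are derivatives in the angle t, not in arc length. Smoothness is stated in terms
  of them, so differentiability of \<open>T\<close>, \<open>k\<close> and \<open>k\<^sub>s\<close>
  is reduced to formulas in \<open>D n\<close> and the speed.\<close>

definition D :: "nat \<Rightarrow> real \<Rightarrow> complex" where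
  "D n = ((\<lambda>g t. vector_derivative g (at t)) ^^ n) (angle_lift \<gamma>)"

abbreviation "v \<equiv> speed \<gamma>"
abbreviation "T \<equiv> unit_tangent \<gamma>"
abbreviation "k \<equiv> curvature \<gamma>"
abbreviation "k\<^sub>s \<equiv> arc_deriv \<gamma> k"

lemma D_deriv: "(D n has_vector_derivative D (Suc n) t) (at t)"
  using smooth
  by (auto simp: D_def smooth_closed_regular_curve_def smooth_on_reals_def differentiable_on_def
      vector_derivative_works)

lemma D_0: "D 0 = angle_lift \<gamma>"
  by (simp add: D_def)

lemma D_1: "D (Suc 0) t = vector_derivative (angle_lift \<gamma>) (at t)"
  by (simp add: D_def)

lemma D_1_nonzero: "D (Suc 0) t \<noteq> 0"
  using smooth by (simp add: D_1 smooth_closed_regular_curve_def)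

lemma speed_eq: "v t = norm (D (Suc 0) t)"
  by (simp add: speed_def D_1)

lemma speed_pos: "v t > 0"
  using D_1_nonzero by (simp add: speed_eq)

lemma speed_nonzero [simp]: "v t \<noteq> 0"
  using speed_pos[of t] by simp

lemma speed_deriv: "(v has_real_derivative (D 1 t \<bullet> D 2 t) / v t) (at t)"
  using has_real_derivative_norm[OF D_deriv D_1_nonzero, of t]
  by (simp add: speed_eq[abs_def] numeral_2_eq_2)

lemma speed_continuous: "continuous_on S v"
  using speed_deriv by (meson DERIV_continuous continuous_at_imp_continuous_on)

lemma arc_deriv_vector:
  "(f has_vector_derivative f') (at t) \<Longrightarrow> arc_deriv \<gamma> f t = f' /\<^sub>R v t"
  by (simp add: arc_deriv_def vector_derivative_at)

lemma arc_deriv_scaled: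
  "f differentiable (at t) \<Longrightarrow> (f has_vector_derivative v t *\<^sub>R arc_deriv \<gamma> f t) (at t)"
  by (simp add: arc_deriv_def vector_derivative_works)

lemma tangent_eq: "T t = D 1 t /\<^sub>R v t"
  by (simp add: unit_tangent_def arc_deriv_def D_1)

lemma tangent_deriv_raw:
  "(T has_vector_derivative
     inverse (v t) *\<^sub>R D 2 t + (- ((D 1 t \<bullet> D 2 t) / v t) / (v t)\<^sup>2) *\<^sub>R D 1 t) (at t)"
proof -
  have "((\<lambda>t. inverse (v t)) has_real_derivative - ((D 1 t \<bullet> D 2 t) / v t) / (v t)\<^sup>2) (at t)"
    by (auto intro!: derivative_eq_intros speed_deriv simp: field_simps power2_eq_square)
  from has_vector_derivative_scaleR[OF this D_deriv[of 1 t]]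
  show ?thesis by (simp add: tangent_eq[abs_def] numeral_2_eq_2)
qed

lemma norm_tangent: "norm (T t) = 1"
  using speed_pos[of t] by (simp add: tangent_eq speed_eq)

text \<open>The Frenet equation in the parameter t: since \<open>T\<close> has constant length 1,
  its derivative is orthogonal to \<open>T\<close>, and the normal component is \<open>v * k\<close>
  by definition of \<open>k\<close>.\<close>

lemma tangent_deriv: "(T has_vector_derivative (v t * k t) *\<^sub>R (\<i> * T t)) (at t)"
proof -
  obtain T' where T': "(T has_vector_derivative T') (at t)"
    using tangent_deriv_raw by blast
  have "((\<lambda>t. norm (T t)) has_real_derivative (T t \<bullet> T') / norm (T t)) (at t)"
    using norm_tangent[of t] by (intro has_real_derivative_norm[OF T']) auto
  then have "((\<lambda>t. 1) has_real_derivative (T t \<bullet> T')) (at t)"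
    by (simp add: norm_tangent)
  then have "T' \<bullet> T t = 0"
    using DERIV_const DERIV_unique by (metis inner_commute)
  then have "T' = (T' \<bullet> (\<i> * T t)) *\<^sub>R (\<i> * T t)"
    by (intro complex_orthogonal_decomp norm_tangent)
  moreover have "T' \<bullet> (\<i> * T t) = v t * k t"
    by (simp add: curvature_def unit_normal_def arc_deriv_vector[OF T'])
  ultimately show ?thesis using T' by simp
qed

text \<open>The classical det(\<open>D 1\<close>, \<open>D 2\<close>) / |\<open>D 1\<close>|^3. The
  part of the derivative of \<open>T\<close> along \<open>D 1\<close> is orthogonal to the normal
  and disappears.\<close>

lemma curvature_eq: "k t = (D 2 t \<bullet> (\<i> * D 1 t)) / (v t) ^ 3"
proof -
  have "D 1 t \<bullet> (\<i> * D 1 t) = 0" by (simp add: inner_complex_def)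
  then show ?thesis
    unfolding curvature_def unit_normal_def arc_deriv_vector[OF tangent_deriv_raw]
    by (simp add: tangent_eq inner_diff_left power3_eq_cube divide_inverse mult_ac)
qed

lemma curvature_deriv:
  "(k has_real_derivative
     (D 3 t \<bullet> (\<i> * D 1 t)) / (v t) ^ 3
     - 3 * (D 2 t \<bullet> (\<i> * D 1 t)) * (D 1 t \<bullet> D 2 t) / (v t) ^ 5) (at t)"
proof -
  have "((\<lambda>t. D 2 t \<bullet> (\<i> * D 1 t)) has_real_derivative
      D 2 t \<bullet> (\<i> * D 2 t) + D 3 t \<bullet> (\<i> * D 1 t)) (at t)"
    using has_real_derivative_inner[OF D_deriv[of 2 t]
        has_vector_derivative_mult_right[OF D_deriv[of 1 t], of \<i>]]
    by (simp add: numeral_3_eq_3 numeral_2_eq_2)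
  moreover have "D 2 t \<bullet> (\<i> * D 2 t) = 0" by (simp add: inner_complex_def)
  ultimately have N: "((\<lambda>t. D 2 t \<bullet> (\<i> * D 1 t)) has_real_derivative D 3 t \<bullet> (\<i> * D 1 t)) (at t)"
    by simp
  show ?thesis
    unfolding curvature_eq[abs_def]
    by (rule derivative_eq_intros N speed_deriv refl | simp)+
      (simp add: field_simps eval_nat_numeral)
qed

text \<open>\<open>k\<^sub>s\<close> is an explicit quotient built from the first three derivatives
  and the speed. Its differentiability permits integrating k_ss by the fundamental theorem of
  calculus.\<close>

lemma curvature_arc_deriv_differentiable: "k\<^sub>s differentiable (at t)"
proof -
  have D: "D n differentiable (at t)" for n
    using D_deriv by (rule differentiableI_vector)
  have v: "v differentiable (at t)"
    using speed_deriv by (auto simp: real_differentiable_def)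
  have inner: "(\<lambda>t. f t \<bullet> g t) differentiable (at t)"
    if "f differentiable (at t)" "g differentiable (at t)" for f g :: "real \<Rightarrow> complex"
    using that has_real_derivative_inner[of f _ t g]
    by (meson real_differentiable_def vector_derivative_works)
  have iD: "(\<lambda>t. \<i> * D n t) differentiable (at t)" for n
    using has_vector_derivative_mult_right[OF D_deriv] by (rule differentiableI_vector)
  have "k\<^sub>s = (\<lambda>t. ((D 3 t \<bullet> (\<i> * D 1 t)) / (v t) ^ 3
     - 3 * (D 2 t \<bullet> (\<i> * D 1 t)) * (D 1 t \<bullet> D 2 t) / (v t) ^ 5) / v t)"
    using arc_deriv_vector[OF curvature_deriv[unfolded has_real_derivative_iff_has_vector_derivative]]
    by (auto simp: fun_eq_iff divide_inverse mult.commute)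
  moreover have "\<dots> differentiable (at t)"
    by (intro differentiable_divide differentiable_diff differentiable_mult differentiable_power
        inner D iD v differentiable_const) auto
  ultimately show ?thesis by simp
qed

lemma curvature_differentiable: "k differentiable (at t)"
  using curvature_deriv by (auto simp: real_differentiable_def)

lemma curvature_arc_deriv_continuous: "continuous_on S k\<^sub>s"
  by (meson curvature_arc_deriv_differentiable continuous_at_imp_continuous_on
      differentiable_imp_continuous_within)

section \<open>Periodicity in the angle\<close>

lemma angle_lift_periodic: "angle_lift \<gamma> (t + 2 * pi) = angle_lift \<gamma> t"
  by (simp add: angle_lift_def cis_mult[symmetric])

lemma arc_deriv_periodic:
  assumes "\<And>t. f (t + 2 * pi) = f t"
  shows "arc_deriv \<gamma> f (t + 2 * pi) = arc_deriv \<gamma> f t"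
proof -
  have "v (t + 2 * pi) = v t"
    by (simp add: speed_def vector_derivative_periodic angle_lift_periodic)
  then show ?thesis
    using assms by (simp add: arc_deriv_def vector_derivative_periodic)
qed

lemma tangent_periodic: "T (t + 2 * pi) = T t"
  unfolding unit_tangent_def by (intro arc_deriv_periodic angle_lift_periodic)

lemma curvature_periodic: "k (t + 2 * pi) = k t"
  by (simp add: curvature_def unit_normal_def tangent_periodic arc_deriv_periodic)

lemma curvature_arc_deriv_periodic: "k\<^sub>s (t + 2 * pi) = k\<^sub>s t"
  by (intro arc_deriv_periodic curvature_periodic)

section \<open>Integrals over the closed curve and the vanishing of h\<close>

lemma integral_arc_deriv:
  fixes f :: "real \<Rightarrow> 'a::banach"
  assumes "\<And>t. f differentiable (at t)" "\<And>t. f (t + 2 * pi) = f t"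
  shows "((\<lambda>t. v t *\<^sub>R arc_deriv \<gamma> f t) has_integral 0) {0..2 * pi}"
proof -
  have "((\<lambda>t. v t *\<^sub>R arc_deriv \<gamma> f t) has_integral f (2 * pi) - f 0) {0..2 * pi}"
    by (intro fundamental_theorem_of_calculus has_vector_derivative_at_within[OF arc_deriv_scaled]
        assms) auto
  then show ?thesis using assms(2)[of 0] by simp
qed

lemma length_pos: "curve_length \<gamma> > 0"
proof -
  have "integral {0..2 * pi} v \<noteq> 0"
    using integral_eq_0_iff[OF speed_continuous, of 0 "2 * pi"] speed_pos
    by (metis atLeastAtMost_iff less_imp_le order_refl pi_gt_zero speed_nonzero
        zero_less_mult_iff zero_less_numeral)
  moreover have "integral {0..2 * pi} v \<ge> 0"
    by (intro integral_nonneg integrable_continuous_real speed_continuous less_imp_le speed_pos)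
  ultimately show ?thesis by (simp add: curve_length_def arc_integral_def)
qed

lemma length_has_integral: "(v has_integral curve_length \<gamma>) {0..2 * pi}"
  using integrable_integral[OF integrable_continuous_real[OF speed_continuous]]
  by (simp add: curve_length_def arc_integral_def)

lemma translating_imp_length_constraint_0:
  assumes "translating_solution \<gamma>"
  shows "length_constraint \<gamma> = 0"
proof -
  let ?h = "length_constraint \<gamma>"
  obtain V where V: "\<And>t. ?h - arc_deriv \<gamma> k\<^sub>s t = V \<bullet> (\<i> * T t)"
    using assms by (auto simp: translating_solution_def flow_normal_velocity_def unit_normal_def)
  have "((\<lambda>t. v t *\<^sub>R arc_deriv \<gamma> (angle_lift \<gamma>) t) has_integral 0) {0..2 * pi}"
    using D_deriv[of 0] angle_lift_periodic
    by (intro integral_arc_deriv) (auto simp: D_0 intro: differentiableI_vector)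
  \<comment> \<open>The closing condition, that the integral of \<open>T\<close> over arc length is
    0, is mapped through the linear form whose value on the tangent is <V, nu>.\<close>
  from has_integral_linear[OF this, of "\<lambda>z. V \<bullet> (\<i> * z)"]
  have "((\<lambda>t. V \<bullet> (\<i> * T t) * v t) has_integral 0) {0..2 * pi}"
    by (simp add: o_def unit_tangent_def mult.commute bounded_linear_intros)
  moreover have "((\<lambda>t. v t * arc_deriv \<gamma> k\<^sub>s t) has_integral 0) {0..2 * pi}"
    using integral_arc_deriv[of k\<^sub>s] curvature_arc_deriv_differentiable
      curvature_arc_deriv_periodic by simp
  then have "((\<lambda>t. ?h * v t - v t * arc_deriv \<gamma> k\<^sub>s t) has_integral
      ?h * curve_length \<gamma> - 0) {0..2 * pi}"
    by (intro has_integral_diff has_integral_mult_right length_has_integral)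
  \<comment> \<open>By the translation equation the same integral is that of h - k_ss, of which only
    the constant h contributes.\<close>
  then have "((\<lambda>t. V \<bullet> (\<i> * T t) * v t) has_integral ?h * curve_length \<gamma>) {0..2 * pi}"
    by (simp add: V[symmetric] algebra_simps)
  ultimately have "?h * curve_length \<gamma> = 0" by (rule has_integral_unique[symmetric])
  then show ?thesis using length_pos by simp
qed

lemma length_constraint_0_imp_curvature_arc_deriv_0:
  assumes "length_constraint \<gamma> = 0" "turning_number \<gamma> \<noteq> 0"
  shows "k\<^sub>s t = 0"
proof -
  \<comment> \<open>The nonzero turning number is essential here: otherwise h would be 0 merely by
    the convention for division by zero.\<close>
  have "integral {0..2 * pi} (\<lambda>t. (k\<^sub>s t)\<^sup>2 * v t) = 0"
    using assms by (simp add: length_constraint_def arc_integral_def)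
  then have "\<forall>t\<in>{0..2 * pi}. (k\<^sub>s t)\<^sup>2 * v t = 0"
    by (subst (asm) integral_eq_0_iff)
      (auto intro!: continuous_intros curvature_arc_deriv_continuous speed_continuous
        simp: less_imp_le[OF speed_pos])
  then have base: "k\<^sub>s t = 0" if "t \<in> {0..2 * pi}" for t
    using that by simp
  \<comment> \<open>The integral controls a single period; integer shifts carry the vanishing to
    every real t.\<close>
  have "k\<^sub>s (t + 2 * pi * of_int n) = k\<^sub>s t" for t and n :: int
  proof -
    have *: "k\<^sub>s (t + 2 * pi * real m) = k\<^sub>s t" for t m
    proof (induction m)
      case (Suc m)
      then show ?case
        using curvature_arc_deriv_periodic[of "t + 2 * pi * real m"] by (simp add: algebra_simps)
    qed simp
    \<comment> \<open>For negative n the forward shift is applied at the point t + 2 pi n, leading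
      back to t.\<close>
    show ?thesis
      using *[of t "nat n"] *[of "t + 2 * pi * of_int n" "nat (- n)"] by (cases "n \<ge> 0") auto
  qed
  moreover have "t - 2 * pi * of_int \<lfloor>t / (2 * pi)\<rfloor> \<in> {0..2 * pi}"
  proof -
    have "frac (t / (2 * pi)) * (2 * pi) \<le> 1 * (2 * pi)"
      by (intro mult_right_mono less_imp_le frac_lt_1) simp
    moreover have "0 \<le> frac (t / (2 * pi)) * (2 * pi)" by simp
    moreover have "t - 2 * pi * of_int \<lfloor>t / (2 * pi)\<rfloor> = frac (t / (2 * pi)) * (2 * pi)"
      by (simp add: frac_def left_diff_distrib)
    ultimately show ?thesis by simp
  qed
  ultimately show ?thesis
    using base by (metis diff_add_cancel)
qed

section \<open>Closed curves of constant nonzero curvature\<close>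

lemma constant_curvature_imp_circle:
  assumes k: "\<And>t. k t = \<kappa>" and "\<kappa> \<noteq> 0"
  shows "round_circle_of_circumference \<gamma> \<bar>turning_number \<gamma>\<bar> (curve_length \<gamma>)"
proof -
  \<comment> \<open>Arc length from the angle 0. It is used on one period only, hence the
    derivatives within the closed interval.\<close>
  define s where "s t = integral {0..t} v" for t
  have s_deriv: "(s has_real_derivative v t) (at t within {0..2 * pi})" if "t \<in> {0..2 * pi}" for t
    unfolding s_def has_real_derivative_iff_has_vector_derivative
    using that by (intro integral_has_vector_derivative speed_continuous)
  have s0: "s 0 = 0" by (simp add: s_def)
  have sL: "s (2 * pi) = curve_length \<gamma>"
    by (simp add: s_def curve_length_def arc_integral_def)
  have s_cont: "continuous_on {0..2 * pi} s"
    using s_deriv by (meson DERIV_continuous continuous_on_eq_continuous_within)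
  have s_mono: "s x < s y" if "0 \<le> x" "x < y" "y \<le> 2 * pi" for x y
  proof (rule DERIV_pos_imp_increasing_open[OF that(2)])
    fix z assume "x < z" "z < y"
    then show "\<exists>d. (s has_real_derivative d) (at z) \<and> 0 < d"
      using s_deriv[of z] that speed_pos[of z] at_within_Icc_at[of 0 z "2 * pi"] by auto
  next
    show "continuous_on {x..y} s" using s_cont that by (auto intro: continuous_on_subset)
  qed
  \<comment> \<open>Multiplying by the inverse rotation solves the Frenet equation: the product has
    derivative 0.\<close>
  have unrotated: "T t * cis (- \<kappa> * s t) = T 0 * cis (- \<kappa> * s 0)" if "t \<in> {0..2 * pi}" for t
  proof -
    have "((\<lambda>t. T t * cis (- \<kappa> * s t)) has_vector_derivative 0) (at t within {0..2 * pi})"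
      if "t \<in> {0..2 * pi}" for t
    proof -
      have "((\<lambda>t. - \<kappa> * s t) has_vector_derivative - \<kappa> * v t) (at t within {0..2 * pi})"
        unfolding has_real_derivative_iff_has_vector_derivative[symmetric]
        by (intro DERIV_cmult s_deriv that)
      moreover have "(cis has_vector_derivative \<i> * cis x) (at x within S)" for x S
        unfolding cis_conv_exp
        by (rule has_vector_derivative_at_within,
            rule has_vector_derivative_real_field[of "\<lambda>z. exp (\<i> * z)"])
          (auto intro!: derivative_eq_intros)
      ultimately have "((\<lambda>t. cis (- \<kappa> * s t)) has_vector_derivative
          (- \<kappa> * v t) *\<^sub>R (\<i> * cis (- \<kappa> * s t))) (at t within {0..2 * pi})"
        by (rule vector_diff_chain_within[unfolded o_def])
      from has_vector_derivative_mult[OF has_vector_derivative_at_within[OF tangent_deriv] this]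
      show ?thesis by (simp add: k scaleR_conv_of_real algebra_simps)
    qed
    then obtain a where "\<And>t. t \<in> {0..2 * pi} \<Longrightarrow> T t * cis (- \<kappa> * s t) = a"
      using has_vector_derivative_zero_constant[of "{0..2 * pi}" "\<lambda>t. T t * cis (- \<kappa> * s t)"]
      by auto
    then show ?thesis using that by simp
  qed
  have T_eq: "T t = T 0 * cis (\<kappa> * s t)" if "t \<in> {0..2 * pi}" for t
  proof -
    have "T t = (T t * cis (- \<kappa> * s t)) * cis (\<kappa> * s t)"
      by (simp add: mult.assoc cis_mult)
    also have "T t * cis (- \<kappa> * s t) = T 0"
      using unrotated[OF that] by (simp add: s0)
    finally show ?thesis .
  qed
  \<comment> \<open>This is the centre of curvature. Its derivative is \<open>v * T\<close> from the
    curve minus \<open>v * T\<close> from the rotating normal.\<close>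
  have "\<exists>c. \<forall>t. angle_lift \<gamma> t + (\<i> * T t) /\<^sub>R \<kappa> = c"
  proof -
    have "((\<lambda>t. angle_lift \<gamma> t + (\<i> * T t) /\<^sub>R \<kappa>) has_vector_derivative 0) (at t)" for t
    proof -
      have "((\<lambda>t. angle_lift \<gamma> t + (\<i> * T t) /\<^sub>R \<kappa>) has_vector_derivative
          D 1 t + (\<i> * ((v t * k t) *\<^sub>R (\<i> * T t))) /\<^sub>R \<kappa>) (at t)"
        using D_deriv[of 0 t]
        by (intro has_vector_derivative_add has_vector_derivative_scaleR[OF DERIV_const, simplified]
            has_vector_derivative_mult_right tangent_deriv) (simp add: D_0)
      then show ?thesis
        using \<open>\<kappa> \<noteq> 0\<close> by (simp add: k tangent_eq scaleR_conv_of_real field_simps)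
    qed
    then show ?thesis
      using has_vector_derivative_zero_constant[of UNIV "\<lambda>t. angle_lift \<gamma> t + (\<i> * T t) /\<^sub>R \<kappa>"]
      by (metis UNIV_I convex_UNIV)
  qed
  then obtain c where c: "\<And>t. angle_lift \<gamma> t + (\<i> * T t) /\<^sub>R \<kappa> = c" by blast
  \<comment> \<open>The vector from the centre to the starting point
    \<open>\<gamma> 1\<close>.\<close>
  define A where "A = - (\<i> * T 0) /\<^sub>R \<kappa>"
  have norm_A: "norm A = 1 / \<bar>\<kappa>\<bar>"
    by (simp add: A_def norm_mult norm_tangent divide_inverse)
  have \<gamma>_eq: "\<gamma> (cis t) = c + A * cis (sgn \<kappa> * (\<bar>\<kappa>\<bar> * s t))" if "t \<in> {0..2 * pi}" for t
  proof -
    \<comment> \<open>The covering lemma wants an increasing angle, so the sign of the curvature is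
      split off as the orientation.\<close>
    have angle: "sgn \<kappa> * (\<bar>\<kappa>\<bar> * s t) = \<kappa> * s t"
      by (simp only: mult.assoc[symmetric] sgn_mult_abs)
    have "\<gamma> (cis t) = c - (\<i> * (T 0 * cis (\<kappa> * s t))) /\<^sub>R \<kappa>"
      unfolding T_eq[OF that, symmetric] c[of t, symmetric] by (simp add: angle_lift_def)
    then show ?thesis
      unfolding angle by (simp add: A_def mult.assoc)
  qed
  \<comment> \<open>The tangent returns to itself after one period, so the total rotation angle is a
    multiple of 2 pi; that multiple is the turning number.\<close>
  have "T (2 * pi) = T 0" using tangent_periodic[of 0] by simp
  then have "cis (\<kappa> * curve_length \<gamma>) = cis 0"
    using T_eq[of "2 * pi"] norm_tangent[of 0] by (auto simp: sL)
  then obtain n :: int where n: "\<kappa> * curve_length \<gamma> = 2 * pi * n"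
    unfolding cis_eq_cis_iff by auto
  define N where "N = nat \<bar>n\<bar>"
  have N: "\<bar>\<kappa>\<bar> * curve_length \<gamma> = 2 * pi * real N"
  proof -
    have "\<bar>\<kappa>\<bar> * curve_length \<gamma> = \<bar>\<kappa> * curve_length \<gamma>\<bar>"
      using length_pos by (simp add: abs_mult)
    also have "\<dots> = 2 * pi * real N"
      unfolding n N_def by (simp add: abs_mult)
    finally show ?thesis .
  qed
  have turning: "turning_number \<gamma> = n"
  proof -
    have "arc_integral \<gamma> k = \<kappa> * curve_length \<gamma>"
      by (simp add: arc_integral_def curve_length_def k)
    then show ?thesis by (simp add: turning_number_def n)
  qed
  note circle = uniform_rotation_covers_circle[of "\<lambda>t. \<bar>\<kappa>\<bar> * s t" N "sgn \<kappa>" A \<gamma> c]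
  have mono: "strict_mono_on {0..2 * pi} (\<lambda>t. \<bar>\<kappa>\<bar> * s t)"
    using s_mono \<open>\<kappa> \<noteq> 0\<close> by (auto intro!: strict_mono_onI mult_strict_left_mono)
  have sgn: "sgn \<kappa> = 1 \<or> sgn \<kappa> = - 1" using \<open>\<kappa> \<noteq> 0\<close> by (auto simp: sgn_if)
  have "A \<noteq> 0" using norm_A \<open>\<kappa> \<noteq> 0\<close> by auto
  have "\<gamma> ` sphere 0 1 = sphere c (norm A)"
    "\<And>p. p \<in> sphere c (norm A) \<Longrightarrow> card {z \<in> sphere 0 1. \<gamma> z = p} = N"
    by (rule circle; use mono sgn \<open>A \<noteq> 0\<close> \<gamma>_eq s0 sL N in \<open>auto intro!: continuous_intros s_cont\<close>)+
  \<comment> \<open>The radius is 1 / |\<open>\<kappa>\<close>|, so |\<open>\<kappa>\<close>| L = 2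
    pi N says that L is N circumferences.\<close>
  moreover have "curve_length \<gamma> = \<bar>turning_number \<gamma>\<bar> * (2 * pi * norm A)"
    using N \<open>\<kappa> \<noteq> 0\<close> by (simp add: turning N_def norm_A field_simps)
  ultimately show ?thesis
    unfolding round_circle_of_circumference_def using \<open>A \<noteq> 0\<close>
    by (intro exI[of _ c] exI[of _ "norm A"]) (auto simp: turning N_def)
qed

end

theorem proposition1p4:
  fixes \<gamma> :: "complex \<Rightarrow> complex" and L\<^sub>0 :: real
  assumes "smooth_closed_regular_curve \<gamma>"
    and "turning_number \<gamma> \<noteq> 0"
    and "translating_solution \<gamma>"
    and "curve_length \<gamma> = L\<^sub>0"
  shows "stationary_solution \<gamma> \<and>
         round_circle_of_circumference \<gamma> \<bar>turning_number \<gamma>\<bar> L\<^sub>0"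
proof -
  interpret smooth_closed_curve \<gamma> by unfold_locales (rule assms(1))
  have h: "length_constraint \<gamma> = 0"
    by (rule translating_imp_length_constraint_0[OF assms(3)])
  have ks: "arc_deriv \<gamma> (curvature \<gamma>) = (\<lambda>t. 0)"
    using length_constraint_0_imp_curvature_arc_deriv_0[OF h assms(2)] by auto
  have "stationary_solution \<gamma>"
    by (simp add: stationary_solution_def flow_normal_velocity_def h ks arc_deriv_def)
  moreover have "(curvature \<gamma> has_vector_derivative 0) (at t)" for t
    using arc_deriv_scaled[OF curvature_differentiable, of t] ks by simp
  then obtain \<kappa> where \<kappa>: "\<And>t. curvature \<gamma> t = \<kappa>"
    using has_vector_derivative_zero_constant[of UNIV "curvature \<gamma>"]
    by (metis UNIV_I convex_UNIV)
  \<comment> \<open>Zero curvature would make the turning number zero.\<close>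
  moreover have "\<kappa> \<noteq> 0"
    using assms(2) \<kappa> by (auto simp: turning_number_def arc_integral_def)
  ultimately show ?thesis
    using constant_curvature_imp_circle[OF \<kappa>] assms(4) by simp
qed

end
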